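(* Let $\Omega$ be a bounded domain of $\mathbb{R}^N$ and let $J(u)=\int_\Omega L(x,u(x),Du(x))\,dx$, $u\in \mathrm{C}^1(\overline\Omega)$, be a variational functional with real-valued Lagrangian $L=L(x,u,z)\in \mathrm{C}^2(\Omega\times\mathbb{R}\times\mathbb{R}^N)\cap \mathrm{C}^1(\overline\Omega\times\mathbb{R}\times\mathbb{R}^N)$ satisfying, for all $x\in\Omega$ and $u\in\mathbb{R}$, $$\sum_{i=1}^N L_{x_iz_i}(x,u,0)=0\qquad\text{and}\qquad L_{x_iu}(x,u,0)=0\ \text{ for all } i=1,\dots,N.$$ Let $u\in \mathrm{C}^2(\Omega)\cap \mathrm{C}^1(\overline\Omega)$ be a real-valued non-trivial function. Then the variational problem $$\delta J(u)v=0\quad\text{for all } v\in\mathcal{D}(\Omega)$$ is equivalent to the problem $$\delta J(u)w=0\quad\text{for all } w\in\mathcal{I}(\Omega),$$ where $\mathcal{I}(\Omega):=\{Du\cdot h:\ h\in\mathcal{D}(\Omega)^N\}$; that is, $u$ satisfies the first condition if and only if it satisfies the second.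
   Context: A domain is an open connected subset of $\mathbb{R}^N$. $\mathrm{C}^1(\overline\Omega)$ denotes the set of restrictions to $\Omega$ of continuously differentiable functions on $\mathbb{R}^N$, and similarly $\mathrm{C}^1(\overline\Omega\times\mathbb{R}\times\mathbb{R}^N)$. $\mathcal{D}(\Omega)$ is the set of real $\mathrm{C}^\infty$ functions with compact support in $\Omega$, and $\mathcal{D}(\Omega)^N$ the set of such $\mathbb{R}^N$-valued functions. For a $\mathrm{C}^1$ function $v$ with compact support in $\Omega$, $\delta J(u)v:=\frac{d}{dt}J(u+tv)\big|_{t=0}$. $Du\cdot h=\sum_{i=1}^N \frac{\partial u}{\partial x_i}h_i$. Subscripts on $L$ denote partial derivatives with respect to the independent variables $x\in\Omega$, $u\in\mathbb{R}$, $z\in\mathbb{R}^N$ ($z$ is the slot for $Du$). A function $u$ is called non-trivial if $Du$ is not identically $0$ in $\Omega$. *)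

theory Defs
  imports "HOL-Analysis.Analysis"
begin

(* For differentiable f this is the directional derivative of f at p in direction e. *)
definition partial_deriv :: "'a::real_normed_vector \<Rightarrow> ('a \<Rightarrow> 'b::real_normed_vector) \<Rightarrow> 'a \<Rightarrow> 'b" where
  "partial_deriv e f p = frechet_derivative f (at p) e"

(* Intended for open S only. In finite dimension this is the usual class C^k; asking for all directions
   e instead of the coordinate directions makes no difference, by linearity of the derivative. *)
primrec Ck_on :: "nat \<Rightarrow> 'a::real_normed_vector set \<Rightarrow> ('a \<Rightarrow> 'b::real_normed_vector) \<Rightarrow> bool" where
  "Ck_on 0 S f \<longleftrightarrow> continuous_on S f"
| "Ck_on (Suc k) S f \<longleftrightarrow>
     (\<forall>p\<in>S. f differentiable (at p)) \<and> (\<forall>e. Ck_on k S (partial_deriv e f))"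

(* C^1 of the closure of S, in the sense of restrictions of C^1 functions on the whole space. *)
definition C1_closure :: "'a::real_normed_vector set \<Rightarrow> ('a \<Rightarrow> 'b::real_normed_vector) \<Rightarrow> bool" where
  "C1_closure S f \<longleftrightarrow> (\<exists>F. Ck_on 1 UNIV F \<and> (\<forall>p\<in>S. F p = f p))"

definition grad :: "(real^'n \<Rightarrow> real) \<Rightarrow> real^'n \<Rightarrow> real^'n" where
  "grad u x = (\<chi> i. partial_deriv (axis i 1) u x)"

(* Test functions are total functions; the support condition forces them to vanish
   outside \<Omega>, so they are identified with their restrictions to \<Omega>. *)
definition test_functions :: "(real^'n) set \<Rightarrow> (real^'n \<Rightarrow> real) set" where
  "test_functions \<Omega> = {v. (\<forall>k. Ck_on k \<Omega> v) \<and>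
     compact (closure {x. v x \<noteq> 0}) \<and> closure {x. v x \<noteq> 0} \<subseteq> \<Omega>}"

definition vector_test_functions :: "(real^'n) set \<Rightarrow> (real^'n \<Rightarrow> real^'n) set" where
  "vector_test_functions \<Omega> = {h. \<forall>i. (\<lambda>x. h x $ i) \<in> test_functions \<Omega>}"

definition inner_variations :: "(real^'n) set \<Rightarrow> (real^'n \<Rightarrow> real) \<Rightarrow> (real^'n \<Rightarrow> real) set" where
  "inner_variations \<Omega> u =
     {(\<lambda>x. \<Sum>i\<in>UNIV. partial_deriv (axis i 1) u x * h x $ i) | h. h \<in> vector_test_functions \<Omega>}"

definition functional ::
  "(real^'n) set \<Rightarrow> ((real^'n) \<times> real \<times> (real^'n) \<Rightarrow> real) \<Rightarrow> (real^'n \<Rightarrow> real) \<Rightarrow> real" where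
  "functional \<Omega> L u = (LINT x:\<Omega>|lborel. L (x, u x, grad u x))"

(* deriv is unspecified where the derivative does not exist. For \<Omega> bounded open, L and u of class
   C^1 up to the boundary and v of class C^1 with compact support in \<Omega>, it does exist. *)
definition first_variation ::
  "((real^'n \<Rightarrow> real) \<Rightarrow> real) \<Rightarrow> (real^'n \<Rightarrow> real) \<Rightarrow> (real^'n \<Rightarrow> real) \<Rightarrow> real" where
  "first_variation J u v = deriv (\<lambda>t. J (\<lambda>x. u x + t * v x)) 0"

(* Directions of the independent variables x_i, u, z_i of a Lagrangian L (x, u, z). *)
definition dir_x :: "'n \<Rightarrow> (real^'n) \<times> real \<times> (real^'n)" where
  "dir_x i = (axis i 1, 0, 0)"

definition dir_u :: "(real^'n) \<times> real \<times> (real^'n)" where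
  "dir_u = (0, 1, 0)"

definition dir_z :: "'n \<Rightarrow> (real^'n) \<times> real \<times> (real^'n)" where
  "dir_z i = (0, 0, axis i 1)"

end

theory Submission imports Defs begin

(* For v of class C^1 with compact support, the first variation is the integral of E * v, where E is
   the Euler-Lagrange expression. Taking w = Du . h for arbitrary h gives E * Du = 0 on the domain.
   Hence Du = 0, so u is locally constant, on the open set V where E is nonzero. There the hypothesis on
   L_{x z} at z = 0 reduces E to L_u(x, c, 0), and the hypothesis on L_{x u} makes this locally
   constant. So for each e distinct from 0 the set {E = e} is open and closed in the domain, and by
   connectedness it is empty or everything. In the latter case Du would vanish identically. *)

section \<open>Calculus of continuously differentiable functions\<close>

text \<open>Limited regularity shapes the proof. As \<open>u\<close> is only C^2, Du . h is only C^1
  and in general not a test function, so the second condition is not a special case of the first.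
  The first variation is therefore computed for every C^1 function with compact support, and each
  condition is compared with the pointwise statement E = 0. Moreover E is only known to be
  continuous, so its local constancy cannot be read off a derivative of E on the whole domain. It
  comes from a collapse of the argument (x, u, Du): where \<open>u\<close> is a constant c near x
  this is (x, c, 0), so every chain-rule term containing a derivative of \<open>u\<close> disappears
  and only derivatives of L in x survive. The hypotheses differentiate L in x first, whereas this
  computation differentiates in x last; hence the need for the symmetry of second
  derivatives.\<close>

lemma partial_derivI:
  assumes "(f has_derivative f') (at p)"
  shows "partial_deriv e f p = f' e"
  using frechet_derivative_at[OF assms] by (simp add: partial_deriv_def)

text \<open>\<open>frechet_derivative\<close> is a choice among all candidates D, and f and g have
  the same candidates at p. So the equality holds even where no derivative exists.\<close>

lemma partial_deriv_cong_open:
  assumes "open S" "p \<in> S" "\<And>x. x \<in> S \<Longrightarrow> f x = g x"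
  shows "partial_deriv e f p = partial_deriv e g p"
proof -
  have "(f has_derivative D) (at p) \<longleftrightarrow> (g has_derivative D) (at p)" for D
    using assms has_derivative_transform_within_open[of _ D p UNIV S]
    by (metis (no_types, lifting))
  then show ?thesis
    by (simp add: partial_deriv_def frechet_derivative_def)
qed

lemma Ck1I:
  assumes "\<And>x. x \<in> S \<Longrightarrow> (f has_derivative f' x) (at x)"
    and "\<And>e. continuous_on S (\<lambda>x. f' x e)"
  shows "Ck_on 1 S f"
proof -
  have "continuous_on S (partial_deriv e f)" for e
    using assms(2)[of e] by (rule continuous_on_eq) (simp add: partial_derivI[OF assms(1)])
  then show ?thesis
    using assms(1) by (auto simp: differentiable_def)
qed

lemma Ck1_has_derivative:
  assumes "Ck_on 1 S f" "x \<in> S"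
  shows "(f has_derivative (\<lambda>e. partial_deriv e f x)) (at x)"
  using assms frechet_derivative_works by (auto simp: partial_deriv_def fun_eq_iff)

lemma Ck1_continuous_partial_deriv:
  assumes "Ck_on 1 S f"
  shows "continuous_on S (partial_deriv e f)"
  using assms by simp

lemma Ck1_continuous_on:
  assumes "Ck_on 1 S f"
  shows "continuous_on S f"
  using Ck1_has_derivative[OF assms] has_derivative_continuous
  by (metis continuous_at_imp_continuous_on)

lemma Ck2_imp_Ck1:
  assumes "Ck_on 2 S f"
  shows "Ck_on 1 S f" "Ck_on 1 S (partial_deriv e f)"
proof -
  have *: "\<forall>x\<in>S. f differentiable (at x)" "\<And>e. Ck_on 1 S (partial_deriv e f)"
    using assms by (simp_all add: numeral_2_eq_2)
  then show "Ck_on 1 S (partial_deriv e f)" by blast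
  show "Ck_on 1 S f"
    using *(1) Ck1_continuous_on[OF *(2)] by simp
qed

lemma partial_deriv_sum_Basis:
  fixes f :: "'a::euclidean_space \<Rightarrow> 'b::real_normed_vector"
  assumes "f differentiable (at p)"
  shows "partial_deriv e f p = (\<Sum>b\<in>Basis. (e \<bullet> b) *\<^sub>R partial_deriv b f p)"
proof -
  have l: "linear (frechet_derivative f (at p))"
    using assms by (rule linear_frechet_derivative)
  have "frechet_derivative f (at p) (\<Sum>b\<in>Basis. (e \<bullet> b) *\<^sub>R b) =
      (\<Sum>b\<in>Basis. (e \<bullet> b) *\<^sub>R frechet_derivative f (at p) b)"
    by (simp add: linear_sum[OF l] linear_scale[OF l])
  then show ?thesis
    by (simp add: partial_deriv_def euclidean_representation)
qed

text \<open>\<open>Ck_on\<close> gives continuity of the derivative for each fixed direction only.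
  Expansion in the finite basis lets the direction vary with the point, as it does in the chain
  rule.\<close>

lemma Ck1_continuous_on_partial_deriv_joint:
  fixes g :: "'a::euclidean_space \<Rightarrow> 'b::real_normed_vector"
  assumes g: "Ck_on 1 T g" and q: "continuous_on S q" "q ` S \<subseteq> T" and w: "continuous_on S w"
  shows "continuous_on S (\<lambda>x. partial_deriv (w x) g (q x))"
proof -
  have "continuous_on S (\<lambda>x. \<Sum>b\<in>Basis. (w x \<bullet> b) *\<^sub>R partial_deriv b g (q x))"
    using g q w
    by (intro continuous_intros continuous_on_compose2[OF Ck1_continuous_partial_deriv]) auto
  then show ?thesis
    by (rule continuous_on_eq)
      (use g q in \<open>auto intro!: partial_deriv_sum_Basis[symmetric]\<close>)
qed

lemma Ck1_compose:
  fixes g :: "'a::euclidean_space \<Rightarrow> 'b::real_normed_vector"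
  assumes g: "Ck_on 1 T g" and q: "Ck_on 1 S q" "q ` S \<subseteq> T"
  shows "Ck_on 1 S (\<lambda>x. g (q x))"
proof (rule Ck1I)
  show "((\<lambda>x. g (q x)) has_derivative (\<lambda>e. partial_deriv (partial_deriv e q x) g (q x))) (at x)"
    if "x \<in> S" for x
    using that q
    by (intro has_derivative_compose[OF Ck1_has_derivative[OF q(1)] Ck1_has_derivative[OF g]]) auto
  show "continuous_on S (\<lambda>x. partial_deriv (partial_deriv e q x) g (q x))" for e
    by (rule Ck1_continuous_on_partial_deriv_joint[OF g Ck1_continuous_on[OF q(1)] q(2)
          Ck1_continuous_partial_deriv[OF q(1)]])
qed

lemma Ck1_bounded_linear:
  assumes "bounded_linear f"
  shows "Ck_on 1 S f"
  by (rule Ck1I[of S f "\<lambda>_. f"]) (auto intro: bounded_linear_imp_has_derivative[OF assms])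

lemma Ck1_const: "Ck_on 1 S (\<lambda>_. c)"
  by (rule Ck1I[of S _ "\<lambda>_ _. 0"]) auto

lemma Ck1_add:
  assumes "Ck_on 1 S f" "Ck_on 1 S g"
  shows "Ck_on 1 S (\<lambda>x. f x + g x)"
  by (rule Ck1I[of S _ "\<lambda>x e. partial_deriv e f x + partial_deriv e g x"])
    (use assms in \<open>auto intro!: has_derivative_add Ck1_has_derivative continuous_intros
        Ck1_continuous_partial_deriv simp del: Ck_on.simps One_nat_def\<close>)

lemma Ck1_sum:
  assumes "finite I" "\<And>i. i \<in> I \<Longrightarrow> Ck_on 1 S (f i)"
  shows "Ck_on 1 S (\<lambda>x. \<Sum>i\<in>I. f i x)"
  using assms
proof (induction I rule: finite_induct)
  case empty
  show ?case using Ck1_const[of S 0] by simp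
next
  case (insert i I)
  then have "Ck_on 1 S (\<lambda>x. f i x + (\<Sum>i\<in>I. f i x))"
    by (intro Ck1_add) auto
  then show ?case using insert.hyps by simp
qed

lemma Ck1_mult:
  fixes f g :: "'a::real_normed_vector \<Rightarrow> real"
  assumes "Ck_on 1 S f" "Ck_on 1 S g"
  shows "Ck_on 1 S (\<lambda>x. f x * g x)"
  by (rule Ck1I[of S _ "\<lambda>x e. f x * partial_deriv e g x + partial_deriv e f x * g x"])
    (use assms Ck1_continuous_on[OF assms(1)] Ck1_continuous_on[OF assms(2)] in
      \<open>auto intro!: has_derivative_mult Ck1_has_derivative continuous_intros
        Ck1_continuous_partial_deriv simp del: Ck_on.simps One_nat_def\<close>)

lemma Ck1_Pair:
  assumes "Ck_on 1 S f" "Ck_on 1 S g"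
  shows "Ck_on 1 S (\<lambda>x. (f x, g x))"
  by (rule Ck1I[of S _ "\<lambda>x e. (partial_deriv e f x, partial_deriv e g x)"])
    (use assms in \<open>auto intro!: has_derivative_Pair Ck1_has_derivative continuous_intros
        Ck1_continuous_partial_deriv simp del: Ck_on.simps One_nat_def\<close>)

lemma Ck1_vec:
  fixes f :: "'a::real_normed_vector \<Rightarrow> real^'n"
  assumes "\<And>i. Ck_on 1 S (\<lambda>x. f x $ i)"
  shows "Ck_on 1 S f"
proof (rule Ck1I)
  show "(f has_derivative (\<lambda>e. \<chi> i. partial_deriv e (\<lambda>x. f x $ i) x)) (at x)" if "x \<in> S" for x
    using Ck1_has_derivative[OF assms that]
    by (subst has_derivative_componentwise_within) (auto simp: Basis_vec_def inner_axis)
  show "continuous_on S (\<lambda>x. \<chi> i. partial_deriv e (\<lambda>x. f x $ i) x)" for e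
    by (intro continuous_on_vec_lambda Ck1_continuous_partial_deriv assms)
qed

lemma Ck1_Un:
  assumes "Ck_on 1 S f" "Ck_on 1 T f" "open S" "open T"
  shows "Ck_on 1 (S \<union> T) f"
  using assms by (auto intro: continuous_on_open_Un)

lemma Ck1_cong_open:
  assumes "open S" "\<And>x. x \<in> S \<Longrightarrow> f x = g x" "Ck_on 1 S f"
  shows "Ck_on 1 S g"
proof (rule Ck1I)
  show "(g has_derivative (\<lambda>e. partial_deriv e f x)) (at x)" if "x \<in> S" for x
    using Ck1_has_derivative[OF assms(3) that] assms that
    by (metis has_derivative_transform_within_open)
  show "continuous_on S (\<lambda>x. partial_deriv e f x)" for e
    by (rule Ck1_continuous_partial_deriv[OF assms(3)])
qed

text \<open>The open sets \<open>\<Omega>\<close> and \<open>- K\<close> cover the space, and f is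
  zero on the second. Regularity known only inside the domain thus becomes global.\<close>

lemma Ck1_extend_zero:
  assumes "open \<Omega>" "compact K" "K \<subseteq> \<Omega>" "Ck_on 1 \<Omega> f" "\<And>x. x \<notin> K \<Longrightarrow> f x = 0"
  shows "Ck_on 1 UNIV f"
proof -
  have o: "open (- K)" using \<open>compact K\<close> by (simp add: compact_imp_closed open_Compl)
  have "Ck_on 1 (- K) f"
    by (rule Ck1_cong_open[OF o _ Ck1_const[of _ 0]]) (use assms(5) in auto)
  then have "Ck_on 1 (\<Omega> \<union> - K) f"
    using assms o by (intro Ck1_Un)
  moreover have "\<Omega> \<union> - K = UNIV" using assms(3) by auto
  ultimately show ?thesis by metis
qed

lemma grad_component: "grad u x $ i = partial_deriv (axis i 1) u x"
  by (simp add: grad_def)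

lemma grad_add_scaleR:
  assumes "u differentiable (at x)" "v differentiable (at x)"
  shows "grad (\<lambda>x. u x + t * v x) x = grad u x + t *\<^sub>R grad v x"
proof -
  have "((\<lambda>x. u x + t * v x) has_derivative (\<lambda>e. partial_deriv e u x + t * partial_deriv e v x)) (at x)"
    using assms frechet_derivative_works unfolding partial_deriv_def
    by (intro has_derivative_add has_derivative_mult_right) blast+
  then show ?thesis
    by (simp add: vec_eq_iff grad_component partial_derivI)
qed

lemma continuous_on_grad:
  assumes "Ck_on 1 S u"
  shows "continuous_on S (grad u)"
  unfolding grad_def
  by (intro continuous_on_vec_lambda Ck1_continuous_partial_deriv assms)

lemma Ck1_grad:
  assumes "Ck_on 2 S u"
  shows "Ck_on 1 S (grad u)"
  by (rule Ck1_vec) (simp add: grad_component Ck2_imp_Ck1[OF assms] del: Ck_on.simps One_nat_def)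

section \<open>Restriction to lines and the symmetry of second derivatives\<close>

lemma has_vector_derivative_line:
  assumes "Ck_on 1 S f" "p + s *\<^sub>R a \<in> S"
  shows "((\<lambda>s. f (p + s *\<^sub>R a)) has_vector_derivative partial_deriv a f (p + s *\<^sub>R a)) (at s)"
proof -
  have "((\<lambda>s. f (p + s *\<^sub>R a)) has_derivative (\<lambda>h. partial_deriv (h *\<^sub>R a) f (p + s *\<^sub>R a))) (at s)"
    by (rule has_derivative_compose[where f="\<lambda>s. p + s *\<^sub>R a" and f'="\<lambda>h. h *\<^sub>R a" and g=f,
          OF _ Ck1_has_derivative[OF assms]]) (auto intro!: derivative_eq_intros)
  moreover have "partial_deriv (h *\<^sub>R a) f (p + s *\<^sub>R a) = h *\<^sub>R partial_deriv a f (p + s *\<^sub>R a)" for h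
    using linear_frechet_derivative[of f "at (p + s *\<^sub>R a)"] assms
    by (simp add: partial_deriv_def linear_scale)
  ultimately show ?thesis
    by (simp add: has_vector_derivative_def)
qed

text \<open>The mean value theorem is applied twice, along a and then along b. The left side is
  symmetric in a and b, which is what makes the mixed derivatives comparable.\<close>

lemma second_difference_mean_value:
  fixes f :: "'a::real_normed_vector \<Rightarrow> real"
  assumes f: "Ck_on 2 S f" and h: "h > 0"
    and S: "\<And>s t. 0 \<le> s \<Longrightarrow> s \<le> h \<Longrightarrow> 0 \<le> t \<Longrightarrow> t \<le> h \<Longrightarrow> p + s *\<^sub>R a + t *\<^sub>R b \<in> S"
  shows "\<exists>s t. 0 < s \<and> s < h \<and> 0 < t \<and> t < h \<and>
    f (p + h *\<^sub>R a + h *\<^sub>R b) - f (p + h *\<^sub>R a) - f (p + h *\<^sub>R b) + f p =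
    h * h * partial_deriv b (partial_deriv a f) (p + s *\<^sub>R a + t *\<^sub>R b)"
proof -
  have f1: "Ck_on 1 S f" "Ck_on 1 S (partial_deriv a f)"
    using Ck2_imp_Ck1[OF f] by blast+
  \<comment> \<open>The second difference is the increment of \<open>\<phi>\<close> between 0 and h,
    itself a difference along b.\<close>
  define \<phi> where "\<phi> s = f ((p + h *\<^sub>R b) + s *\<^sub>R a) - f (p + s *\<^sub>R a)" for s
  have "\<exists>s>0. s < h \<and> \<phi> h - \<phi> 0 = (h - 0) *
      (partial_deriv a f ((p + h *\<^sub>R b) + s *\<^sub>R a) - partial_deriv a f (p + s *\<^sub>R a))"
  proof (rule MVT2[OF h])
    fix s assume s: "0 \<le> s" "s \<le> h"
    show "(\<phi> has_field_derivative
        (partial_deriv a f ((p + h *\<^sub>R b) + s *\<^sub>R a) - partial_deriv a f (p + s *\<^sub>R a))) (at s)"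
      unfolding \<phi>_def has_real_derivative_iff_has_vector_derivative
      using S[OF s, of h] S[OF s, of 0] h
      by (intro has_vector_derivative_diff has_vector_derivative_line[OF f1(1)]) (auto simp: algebra_simps)
  qed
  then obtain s where s: "0 < s" "s < h" and e1: "\<phi> h - \<phi> 0 = h *
      (partial_deriv a f (p + s *\<^sub>R a + h *\<^sub>R b) - partial_deriv a f (p + s *\<^sub>R a + 0 *\<^sub>R b))"
    by (auto simp: algebra_simps)
  have "\<exists>t>0. t < h \<and> partial_deriv a f (p + s *\<^sub>R a + h *\<^sub>R b) - partial_deriv a f (p + s *\<^sub>R a + 0 *\<^sub>R b) =
      (h - 0) * partial_deriv b (partial_deriv a f) (p + s *\<^sub>R a + t *\<^sub>R b)"
  proof (rule MVT2[OF h])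
    fix t assume t: "0 \<le> t" "t \<le> h"
    show "((\<lambda>t. partial_deriv a f (p + s *\<^sub>R a + t *\<^sub>R b)) has_field_derivative
        partial_deriv b (partial_deriv a f) (p + s *\<^sub>R a + t *\<^sub>R b)) (at t)"
      unfolding has_real_derivative_iff_has_vector_derivative
      using S[of s t] s t by (intro has_vector_derivative_line[OF f1(2)]) auto
  qed
  then obtain t where "0 < t" "t < h"
    "partial_deriv a f (p + s *\<^sub>R a + h *\<^sub>R b) - partial_deriv a f (p + s *\<^sub>R a + 0 *\<^sub>R b) =
      h * partial_deriv b (partial_deriv a f) (p + s *\<^sub>R a + t *\<^sub>R b)"
    by auto
  moreover have "\<phi> h - \<phi> 0 =
      f (p + h *\<^sub>R a + h *\<^sub>R b) - f (p + h *\<^sub>R a) - f (p + h *\<^sub>R b) + f p"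
    by (simp add: \<phi>_def algebra_simps)
  ultimately show ?thesis
    using s e1 by (intro exI[of _ s] exI[of _ t]) (auto simp: mult.assoc)
qed

text \<open>Schwarz's theorem: by the symmetric second difference the two mixed derivatives take a
  common value at two points arbitrarily close to p. By continuity they cannot then differ at
  p.\<close>

lemma partial_deriv_commute:
  fixes f :: "'a::real_normed_vector \<Rightarrow> real"
  assumes S: "open S" "p \<in> S" and f: "Ck_on 2 S f"
  shows "partial_deriv b (partial_deriv a f) p = partial_deriv a (partial_deriv b f) p"
proof (rule ccontr)
  let ?A = "partial_deriv b (partial_deriv a f)" and ?B = "partial_deriv a (partial_deriv b f)"
  assume "?A p \<noteq> ?B p"
  then have e: "dist (?A p) (?B p) / 2 > 0" by simp
  have cont: "isCont ?A p" "isCont ?B p"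
    using Ck1_continuous_partial_deriv[OF Ck2_imp_Ck1(2)[OF f]] S
    by (simp_all add: continuous_on_eq_continuous_at)
  obtain d1 where d1: "d1 > 0" "\<And>x. dist x p < d1 \<Longrightarrow> dist (?A x) (?A p) < dist (?A p) (?B p) / 2"
    using cont(1) e unfolding continuous_at_eps_delta by meson
  obtain d2 where d2: "d2 > 0" "\<And>x. dist x p < d2 \<Longrightarrow> dist (?B x) (?B p) < dist (?A p) (?B p) / 2"
    using cont(2) e unfolding continuous_at_eps_delta by meson
  obtain d3 where d3: "d3 > 0" "\<And>x. dist x p < d3 \<Longrightarrow> x \<in> S"
    using S open_dist by blast
  define d where "d = min d1 (min d2 d3)"
  \<comment> \<open>The summand 1 keeps the denominator positive when a and b vanish, and makes the
    bound strict: the whole parallelogram of side parameter h stays within distance d of p.\<close>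
  define h where "h = d / (norm a + norm b + 1)"
  have d: "d > 0" using d1 d2 d3 by (simp add: d_def)
  have h: "h > 0" using d by (simp add: h_def add_nonneg_pos)
  have near: "dist (p + s *\<^sub>R a + t *\<^sub>R b) p < d" if "0 \<le> s" "s \<le> h" "0 \<le> t" "t \<le> h" for s t
  proof -
    have "dist (p + s *\<^sub>R a + t *\<^sub>R b) p = norm (s *\<^sub>R a + t *\<^sub>R b)"
      by (simp add: dist_norm algebra_simps)
    also have "\<dots> \<le> s * norm a + t * norm b"
      using norm_triangle_ineq[of "s *\<^sub>R a" "t *\<^sub>R b"] that by simp
    also have "\<dots> \<le> h * norm a + h * norm b"
      using that by (intro add_mono mult_right_mono) auto
    also have "\<dots> < h * (norm a + norm b + 1)"
      using h by (simp add: algebra_simps)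
    also have "\<dots> = d" by (simp add: h_def) (smt (verit) norm_ge_zero)
    finally show ?thesis .
  qed
  have near': "dist (p + s *\<^sub>R b + t *\<^sub>R a) p < d" if "0 \<le> s" "s \<le> h" "0 \<le> t" "t \<le> h" for s t
    using near[OF that(3,4,1,2)] by (simp add: add.commute add.left_commute)
  obtain s t where 1: "0 < s" "s < h" "0 < t" "t < h"
    "f (p + h *\<^sub>R a + h *\<^sub>R b) - f (p + h *\<^sub>R a) - f (p + h *\<^sub>R b) + f p =
      h * h * ?A (p + s *\<^sub>R a + t *\<^sub>R b)"
    using second_difference_mean_value[OF f h, of p a b] near d3 by (force simp: d_def)
  obtain s' t' where 2: "0 < s'" "s' < h" "0 < t'" "t' < h"
    "f (p + h *\<^sub>R b + h *\<^sub>R a) - f (p + h *\<^sub>R b) - f (p + h *\<^sub>R a) + f p =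
      h * h * ?B (p + s' *\<^sub>R b + t' *\<^sub>R a)"
    using second_difference_mean_value[OF f h, of p b a] near' d3 by (force simp: d_def)
  have "h * h * ?A (p + s *\<^sub>R a + t *\<^sub>R b) = h * h * ?B (p + s' *\<^sub>R b + t' *\<^sub>R a)"
    unfolding 1(5)[symmetric] 2(5)[symmetric]
    by (simp add: add.assoc add.commute[of "h *\<^sub>R b"])
  then have "?A (p + s *\<^sub>R a + t *\<^sub>R b) = ?B (p + s' *\<^sub>R b + t' *\<^sub>R a)"
    using h by simp
  moreover have "dist (?A (p + s *\<^sub>R a + t *\<^sub>R b)) (?A p) < dist (?A p) (?B p) / 2"
    by (rule d1(2)) (use near[of s t] 1 in \<open>auto simp: d_def\<close>)
  moreover have "dist (?B (p + s' *\<^sub>R b + t' *\<^sub>R a)) (?B p) < dist (?A p) (?B p) / 2"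
    by (rule d2(2)) (use near'[of s' t'] 2 in \<open>auto simp: d_def\<close>)
  ultimately show False
    using dist_triangle_half_l by (metis dist_commute order.irrefl)
qed

section \<open>Integrals of functions with bounded support\<close>

lemma continuous_on_extend_zero:
  fixes f :: "'a::t2_space \<Rightarrow> 'b::{topological_space, zero}"
  assumes "open \<Omega>" "compact K" "K \<subseteq> \<Omega>" "continuous_on \<Omega> f" "\<And>x. x \<notin> K \<Longrightarrow> f x = 0"
  shows "continuous_on UNIV f"
proof -
  have "continuous_on (- K) f"
    by (rule continuous_on_eq[of _ "\<lambda>_. 0"]) (use assms(5) in auto)
  moreover have "\<Omega> \<union> - K = UNIV" "open (- K)"
    using assms(2,3) by (auto simp: compact_imp_closed open_Compl)
  ultimately show ?thesis
    using continuous_on_open_Un assms(1,4) by metis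
qed

text \<open>Bridge between the Lebesgue integral of the functional and the gauge integral over a
  box, to which the Leibniz rule and the vanishing criterion for nonnegative functions are
  applied.\<close>

lemma integral_lborel_eq_integral_cbox:
  fixes f :: "'a::euclidean_space \<Rightarrow> real"
  assumes "continuous_on UNIV f" "\<And>x. x \<notin> cbox a b \<Longrightarrow> f x = 0"
  shows "integrable lborel f" "integral\<^sup>L lborel f = integral (cbox a b) f"
proof -
  have eq: "(\<lambda>x. indicator (cbox a b) x *\<^sub>R f x) = f"
    using assms(2) by (fastforce simp: indicator_def)
  have i: "set_integrable lborel (cbox a b) f"
    unfolding set_integrable_def
    by (intro borel_integrable_compact continuous_on_subset[OF assms(1)]) auto
  then show "integrable lborel f"
    unfolding set_integrable_def eq .
  show "integral\<^sup>L lborel f = integral (cbox a b) f"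
    using set_borel_integral_eq_integral(2)[OF i] unfolding set_lebesgue_integral_def eq .
qed

lemma integrable_bounded_support:
  fixes f :: "'a::euclidean_space \<Rightarrow> real"
  assumes "continuous_on UNIV f" "bounded B" "\<And>x. x \<notin> B \<Longrightarrow> f x = 0"
  shows "integrable lborel f"
  using assms bounded_subset_cbox_symmetric[OF assms(2)] integral_lborel_eq_integral_cbox(1)[of f]
  by (metis subsetD)

text \<open>The support condition is asked for \<open>\<bar>t\<bar> < 1\<close> only, because the
  support may move with t, as it does under translation; all of it then fits into one box, where the
  Leibniz rule applies.\<close>

lemma has_derivative_integral_bounded_support:
  fixes g :: "real \<Rightarrow> 'a::euclidean_space \<Rightarrow> real"
  assumes d: "\<And>t x. ((\<lambda>t. g t x) has_real_derivative g' t x) (at t)"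
    and c: "continuous_on UNIV (\<lambda>(t, x). g' t x)" "\<And>t. continuous_on UNIV (g t)"
    and B: "bounded B" "\<And>t x. \<bar>t\<bar> < 1 \<Longrightarrow> x \<notin> B \<Longrightarrow> g t x = 0"
  shows "((\<lambda>t. LINT x|lborel. g t x) has_real_derivative (LINT x|lborel. g' 0 x)) (at 0)"
proof -
  obtain a where a: "B \<subseteq> cbox (- a) a"
    using bounded_subset_cbox_symmetric[OF B(1)] by metis
  \<comment> \<open>Outside B the function of t is constantly 0 near 0, so its derivative at 0 is
    0.\<close>
  have g'0: "g' 0 x = 0" if "x \<notin> B" for x
  proof -
    have "((\<lambda>t. 0) has_real_derivative g' 0 x) (at 0)"
      using d[of x 0] B(2) that
      by (auto elim!: has_field_derivative_transform_within_open[where S="ball 0 1"])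
    then show ?thesis
      using DERIV_const DERIV_unique by blast
  qed
  have c0: "continuous_on UNIV (g' 0)"
    using continuous_on_compose2[OF c(1), of UNIV "\<lambda>x. (0, x)"]
    by (simp add: continuous_on_Pair continuous_on_id continuous_on_const)
  have "((\<lambda>t. integral (cbox (- a) a) (g t)) has_real_derivative integral (cbox (- a) a) (g' 0))
      (at 0 within ball 0 1)"
    by (rule leibniz_rule_field_derivative)
      (auto intro: has_field_derivative_at_within[OF d] integrable_continuous
        continuous_on_subset[OF c(1)] continuous_on_subset[OF c(2)])
  then have "((\<lambda>t. integral (cbox (- a) a) (g t)) has_real_derivative integral (cbox (- a) a) (g' 0)) (at 0)"
    by (simp add: at_within_open[where S="ball 0 1"])
  moreover have "integral (cbox (- a) a) (g' 0) = (LINT x|lborel. g' 0 x)"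
    using integral_lborel_eq_integral_cbox(2)[OF c0] g'0 a by (metis subsetD)
  moreover have "integral (cbox (- a) a) (g t) = (LINT x|lborel. g t x)" if "t \<in> ball 0 1" for t
    using integral_lborel_eq_integral_cbox(2)[OF c(2)] B(2) a that
    by (metis (no_types, opaque_lifting) subsetD mem_ball_0 real_norm_def)
  ultimately show ?thesis
    using has_field_derivative_transform_within_open[where S="ball 0 1"]
    by (metis (no_types, lifting) open_ball centre_in_ball zero_less_one)
qed

text \<open>By translation invariance of Lebesgue measure the integral of f(x + t e) is independent
  of t; differentiating under the integral at t = 0 gives the claim. This serves as the divergence
  theorem behind the integration by parts.\<close>

lemma integral_partial_deriv_eq_0:
  fixes f :: "'a::euclidean_space \<Rightarrow> real"
  assumes f: "Ck_on 1 UNIV f" and B: "bounded B" "\<And>x. x \<notin> B \<Longrightarrow> f x = 0"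
  shows "(LINT x|lborel. partial_deriv e f x) = 0"
proof -
  have c: "continuous_on UNIV f" "continuous_on UNIV (partial_deriv e f)"
    using Ck1_continuous_on[OF f] Ck1_continuous_partial_deriv[OF f] by auto
  obtain M where M: "\<And>x. x \<in> B \<Longrightarrow> norm x \<le> M"
    using B(1) bounded_iff by metis
  have "((\<lambda>t. LINT x|lborel. f (x + t *\<^sub>R e)) has_real_derivative
      (LINT x|lborel. partial_deriv e f (x + 0 *\<^sub>R e))) (at 0)"
  proof (rule has_derivative_integral_bounded_support)
    show "((\<lambda>t. f (x + t *\<^sub>R e)) has_real_derivative partial_deriv e f (x + t *\<^sub>R e)) (at t)" for t x
      using has_vector_derivative_line[OF f]
      by (simp add: has_real_derivative_iff_has_vector_derivative)
    show "continuous_on UNIV (\<lambda>(t, x). partial_deriv e f (x + t *\<^sub>R e))"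
      unfolding split_def
      by (rule continuous_on_compose2[OF c(2)]) (auto intro!: continuous_intros)
    show "continuous_on UNIV (\<lambda>x. f (x + t *\<^sub>R e))" for t
      by (rule continuous_on_compose2[OF c(1)]) (auto intro!: continuous_intros)
    \<comment> \<open>A shift by t e with \<open>\<bar>t\<bar> < 1\<close> moves points by at most
      \<open>norm e\<close>, hence this radius.\<close>
    show "bounded (cball (0::'a) (M + norm e))" by simp
    show "f (x + t *\<^sub>R e) = 0" if t: "\<bar>t\<bar> < 1" and x: "x \<notin> cball 0 (M + norm e)" for t x
    proof (rule B(2), rule notI)
      assume "x + t *\<^sub>R e \<in> B"
      then have "norm (x + t *\<^sub>R e) \<le> M" by (rule M)
      moreover have "norm x \<le> norm (x + t *\<^sub>R e) + norm (t *\<^sub>R e)"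
        using norm_triangle_ineq4[of "x + t *\<^sub>R e" "t *\<^sub>R e"] by simp
      moreover have "norm (t *\<^sub>R e) \<le> norm e"
        using t mult_right_mono[of "\<bar>t\<bar>" 1 "norm e"] by simp
      ultimately show False using x by simp
    qed
  qed
  moreover have "(LINT x|lborel. f (x + t *\<^sub>R e)) = (LINT x|lborel. f x)" for t
  proof -
    have "f \<in> borel_measurable borel" using c(1) by (rule borel_measurable_continuous_onI)
    then have "(LINT x|distr lborel borel ((+) (t *\<^sub>R e)). f x) = (LINT x|lborel. f (t *\<^sub>R e + x))"
      by (intro integral_distr) auto
    then show ?thesis
      by (simp add: lborel_distr_plus add.commute)
  qed
  ultimately have "((\<lambda>t::real. LINT x|lborel. f x) has_real_derivative
      (LINT x|lborel. partial_deriv e f x)) (at 0)"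
    by simp
  then show ?thesis
    using DERIV_const DERIV_unique by blast
qed

section \<open>Test functions\<close>

text \<open>The classical smooth function exp(-1/t), extended by zero. The powers of t in the
  denominator make the family closed under differentiation up to linear combinations.\<close>

definition exp_cutoff :: "nat \<Rightarrow> real \<Rightarrow> real" where
  "exp_cutoff n t = (if t > 0 then exp (- (1 / t)) / t ^ n else 0)"

text \<open>With s = 1/t the right-hand limit is that of s^n / exp s at infinity.\<close>

lemma exp_cutoff_tendsto_0: "(exp_cutoff n \<longlongrightarrow> 0) (at 0)"
proof -
  have "((\<lambda>t::real. inverse t ^ n / exp (inverse t)) \<longlongrightarrow> 0) (at_right 0)"
    by (rule filterlim_compose[OF tendsto_power_div_exp_0 filterlim_inverse_at_top_right])
  moreover have "\<forall>\<^sub>F t in at_right (0::real). inverse t ^ n / exp (inverse t) = exp_cutoff n t"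
    by (rule eventually_at_rightI[of 0 1])
      (auto simp: exp_cutoff_def exp_minus field_simps)
  ultimately have "(exp_cutoff n \<longlongrightarrow> 0) (at_right 0)"
    using tendsto_cong by fastforce
  moreover have "\<forall>\<^sub>F t in at_left (0::real). 0 = exp_cutoff n t"
    by (rule eventually_at_leftI[of "-1" 0]) (auto simp: exp_cutoff_def)
  then have "(exp_cutoff n \<longlongrightarrow> 0) (at_left 0)"
    using tendsto_cong tendsto_const by fastforce
  ultimately show ?thesis
    by (simp add: filterlim_at_split)
qed

lemma exp_cutoff_has_derivative:
  "(exp_cutoff n has_real_derivative exp_cutoff (n + 2) t - n * exp_cutoff (n + 1) t) (at t)"
proof -
  consider "t > 0" | "t < 0" | "t = 0" by linarith
  then show ?thesis
  proof cases
    case 1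
    have "((\<lambda>t. exp (- (1 / t)) / t ^ n) has_real_derivative
        (exp (- (1 / t)) * (1 / t\<^sup>2) * t ^ n - exp (- (1 / t)) * (n * t ^ (n - 1))) / (t ^ n * t ^ n)) (at t)"
      using 1 by (auto intro!: derivative_eq_intros simp: power2_eq_square)
    moreover have "(exp (- (1 / t)) * (1 / t\<^sup>2) * t ^ n - exp (- (1 / t)) * (n * t ^ (n - 1))) / (t ^ n * t ^ n) =
        exp_cutoff (n + 2) t - n * exp_cutoff (n + 1) t"
      using 1 by (cases n) (simp_all add: exp_cutoff_def field_simps power2_eq_square)
    ultimately have "((\<lambda>t. exp (- (1 / t)) / t ^ n) has_real_derivative
        exp_cutoff (n + 2) t - n * exp_cutoff (n + 1) t) (at t)"
      by metis
    then show ?thesis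
      by (rule has_field_derivative_transform_within_open[where S="{0<..}"])
        (use 1 in \<open>auto simp: exp_cutoff_def\<close>)
  next
    case 2
    have "((\<lambda>t. 0) has_real_derivative exp_cutoff (n + 2) t - n * exp_cutoff (n + 1) t) (at t)"
      using 2 by (simp add: exp_cutoff_def)
    then show ?thesis
      by (rule has_field_derivative_transform_within_open[where S="{..<0}"])
        (use 2 in \<open>auto simp: exp_cutoff_def\<close>)
  next
    case 3
    \<comment> \<open>The difference quotient at 0 is the next member of the family, so the
      derivative there is its limit 0. This is the claimed value, as all members vanish at
      0.\<close>
    have "(exp_cutoff n (0 + h) - exp_cutoff n 0) / h = exp_cutoff (n + 1) h" if "h \<noteq> 0" for h
      using that by (auto simp: exp_cutoff_def)
    then have "((\<lambda>h. (exp_cutoff n (0 + h) - exp_cutoff n 0) / h) \<longlongrightarrow> 0) (at 0)"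
      using exp_cutoff_tendsto_0[of "n + 1"]
      by (subst LIM_equal[where g="exp_cutoff (n + 1)"]) auto
    then show ?thesis
      using 3 by (simp add: DERIV_def exp_cutoff_def)
  qed
qed

text \<open>A class of functions that contains the bump function and is closed under directional
  derivatives, so that all its members are smooth.\<close>

inductive bump_combination :: "'a::real_inner \<Rightarrow> real \<Rightarrow> ('a \<Rightarrow> real) \<Rightarrow> bool" for c r where
  cutoff: "bump_combination c r (\<lambda>x. exp_cutoff n (r - (x - c) \<bullet> (x - c)))"
| affine_mult: "bump_combination c r f \<Longrightarrow> bump_combination c r (\<lambda>x. (d + a \<bullet> x) * f x)"
| add: "bump_combination c r f \<Longrightarrow> bump_combination c r g \<Longrightarrow> bump_combination c r (\<lambda>x. f x + g x)"

lemma bump_combination_has_derivative: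
  assumes "bump_combination c r f"
  shows "\<exists>f'. (\<forall>x. (f has_derivative f' x) (at x)) \<and> (\<forall>e. bump_combination c r (\<lambda>x. f' x e))"
  using assms
proof induction
  case (cutoff n)
  let ?q = "\<lambda>x. r - (x - c) \<bullet> (x - c)"
  \<comment> \<open>The chain-rule factor -2 (x - c) . e is written as d + a . x, affine in x, so
    that each summand is an instance of \<open>affine_mult\<close>.\<close>
  let ?D = "\<lambda>x e. (2 * (c \<bullet> e) + (- 2 *\<^sub>R e) \<bullet> x) * exp_cutoff (n + 2) (?q x) +
      (- 2 * n * (c \<bullet> e) + (2 * n) *\<^sub>R e \<bullet> x) * exp_cutoff (n + 1) (?q x)"
  have "((\<lambda>x. exp_cutoff n (?q x)) has_derivative ?D x) (at x)" for x
  proof -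
    have "(?q has_derivative (\<lambda>e. - 2 * ((x - c) \<bullet> e))) (at x)"
      by (auto intro!: derivative_eq_intros simp: inner_commute)
    from has_derivative_compose[OF this exp_cutoff_has_derivative[unfolded has_field_derivative_def]]
    show ?thesis
      by (rule has_derivative_eq_rhs)
        (auto simp: fun_eq_iff algebra_simps inner_diff_left inner_commute)
  qed
  moreover have "bump_combination c r (\<lambda>x. ?D x e)" for e
    by (intro bump_combination.intros)
  ultimately show ?case by (intro exI[of _ ?D]) blast
next
  case (affine_mult f d a)
  then obtain f' where f': "\<And>x. (f has_derivative f' x) (at x)" "\<And>e. bump_combination c r (\<lambda>x. f' x e)"
    by blast
  \<comment> \<open>The padding \<open>0 \<bullet> x\<close> presents the constant
    \<open>a \<bullet> e\<close> as an affine factor.\<close>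
  have "((\<lambda>x. (d + a \<bullet> x) * f x) has_derivative (\<lambda>e. (d + a \<bullet> x) * f' x e + (a \<bullet> e + 0 \<bullet> x) * f x)) (at x)" for x
    by (auto intro!: derivative_eq_intros f')
  moreover have "bump_combination c r (\<lambda>x. (d + a \<bullet> x) * f' x e + (a \<bullet> e + 0 \<bullet> x) * f x)" for e
    by (intro bump_combination.intros f' affine_mult.hyps)
  ultimately show ?case
    by (intro exI[of _ "\<lambda>x e. (d + a \<bullet> x) * f' x e + (a \<bullet> e + 0 \<bullet> x) * f x"]) blast
next
  case (add f g)
  then obtain f' g' where fg: "\<And>x. (f has_derivative f' x) (at x)" "\<And>e. bump_combination c r (\<lambda>x. f' x e)"
    "\<And>x. (g has_derivative g' x) (at x)" "\<And>e. bump_combination c r (\<lambda>x. g' x e)"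
    by blast
  then show ?case
    by (intro exI[of _ "\<lambda>x e. f' x e + g' x e"] conjI allI has_derivative_add bump_combination.add)
qed

lemma bump_combination_Ck_on:
  assumes "bump_combination c r f"
  shows "Ck_on k S f"
  using assms
proof (induction k arbitrary: f)
  case 0
  then obtain f' where "\<And>x. (f has_derivative f' x) (at x)"
    using bump_combination_has_derivative by blast
  then show ?case
    by (auto intro!: continuous_at_imp_continuous_on has_derivative_continuous)
next
  case (Suc k)
  then obtain f' where f': "\<And>x. (f has_derivative f' x) (at x)" "\<And>e. bump_combination c r (\<lambda>x. f' x e)"
    using bump_combination_has_derivative by blast
  then have "partial_deriv e f = (\<lambda>x. f' x e)" for e
    by (auto simp: partial_derivI)
  with Suc.IH f' show ?case
    by (auto simp: differentiable_def)
qed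

text \<open>The cutoff is composed with r^2 - |x - c|^2, a polynomial, hence smooth also at the
  centre, and positive exactly on the open ball.\<close>

lemma exists_test_function:
  fixes c :: "real^'n"
  assumes "r > 0" "cball c r \<subseteq> \<Omega>"
  shows "\<exists>v\<in>test_functions \<Omega>. (\<forall>x. v x \<ge> 0) \<and> v c > 0 \<and> (\<forall>x. x \<notin> cball c r \<longrightarrow> v x = 0)"
proof -
  define v where "v x = exp_cutoff 0 (r\<^sup>2 - (x - c) \<bullet> (x - c))" for x
  have supp: "v x = 0" if "x \<notin> cball c r" for x
  proof -
    have "r < norm (x - c)" using that by (simp add: dist_norm norm_minus_commute)
    then have "r\<^sup>2 < (norm (x - c))\<^sup>2"
      using assms(1) by (intro power_strict_mono) auto
    then show ?thesis by (simp add: v_def exp_cutoff_def power2_norm_eq_inner)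
  qed
  have cl: "closure {x. v x \<noteq> 0} \<subseteq> cball c r"
    by (rule closure_minimal) (use supp in blast, simp)
  have "Ck_on k \<Omega> v" for k
    unfolding v_def by (rule bump_combination_Ck_on[OF bump_combination.cutoff])
  moreover have "compact (closure {x. v x \<noteq> 0})"
    using cl bounded_subset compact_eq_bounded_closed by blast
  ultimately have "v \<in> test_functions \<Omega>"
    using cl assms(2) by (auto simp: test_functions_def)
  moreover have "v c > 0" "\<forall>x. v x \<ge> 0"
    using assms(1) by (auto simp: v_def exp_cutoff_def)
  ultimately show ?thesis using supp by blast
qed

lemma test_function_support:
  assumes "v \<in> test_functions \<Omega>"
  obtains K where "compact K" "K \<subseteq> \<Omega>" "\<And>x. x \<notin> K \<Longrightarrow> v x = 0"
proof
  show "v x = 0" if "x \<notin> closure {x. v x \<noteq> 0}" for x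
    using that closure_subset[of "{x. v x \<noteq> 0}"] by blast
qed (use assms in \<open>auto simp: test_functions_def\<close>)

text \<open>Near a point where f is nonzero its sign is constant, so a bump supported there would
  give a nonzero integral.\<close>

lemma fundamental_lemma_calculus_of_variations:
  fixes f :: "real^'n \<Rightarrow> real"
  assumes \<Omega>: "open \<Omega>" and f: "continuous_on \<Omega> f"
    and zero: "\<And>v. v \<in> test_functions \<Omega> \<Longrightarrow> (LINT x|lborel. f x * v x) = 0"
    and x: "x \<in> \<Omega>"
  shows "f x = 0"
proof (rule ccontr)
  assume nz: "f x \<noteq> 0"
  \<comment> \<open>Multiplying by the sign of \<open>f x\<close> treats both signs at once.\<close>
  define g where "g y = sgn (f x) * f y" for y
  have "continuous_on \<Omega> g" "g x > 0"
    using f nz by (auto simp: g_def sgn_if intro!: continuous_intros)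
  then have "open {y\<in>\<Omega>. g y > 0}"
    using continuous_open_preimage[OF _ \<Omega>, of g "{0<..}"] by (simp add: vimage_def Int_def)
  then obtain r where r: "r > 0" "cball x r \<subseteq> {y\<in>\<Omega>. g y > 0}"
    using \<open>g x > 0\<close> x open_contains_cball by (metis (mono_tags, lifting) mem_Collect_eq)
  obtain v where v: "v \<in> test_functions \<Omega>" "\<And>y. v y \<ge> 0" "v x > 0" "\<And>y. y \<notin> cball x r \<Longrightarrow> v y = 0"
    using exists_test_function[OF r(1), of x \<Omega>] r(2) by blast
  have gv: "g y * v y \<ge> 0" for y
    using v(2)[of y] v(4)[of y] r(2) by (cases "y \<in> cball x r") (fastforce intro: mult_nonneg_nonneg)+
  have "continuous_on \<Omega> v"
    using v(1) by (auto simp: test_functions_def dest: spec[of _ "0::nat"])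
  then have c: "continuous_on UNIV (\<lambda>y. g y * v y)"
    using r(2) v(4) \<open>continuous_on \<Omega> g\<close> \<Omega>
    by (intro continuous_on_extend_zero[of \<Omega> "cball x r"] continuous_intros) auto
  \<comment> \<open>Here 1 is the vector of ones; including \<open>x - 1\<close> and
    \<open>x + 1\<close> puts x in the interior of the box, so that this interior is nonempty as the
    vanishing criterion requires.\<close>
  have "bounded (cball x r \<union> {x - 1, x + 1})" by simp
  then obtain a where a: "cball x r \<union> {x - 1, x + 1} \<subseteq> cbox (- a) a"
    using bounded_subset_cbox_symmetric by blast
  have supp: "g y * v y = 0" if "y \<notin> cbox (- a) a" for y
    using that a v(4)[of y] by (metis UnCI mult_zero_right subsetD)
  have "(LINT y|lborel. g y * v y) = 0"
    using zero[OF v(1)] by (simp add: g_def mult.assoc)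
  then have "integral (cbox (- a) a) (\<lambda>y. g y * v y) = 0"
    using integral_lborel_eq_integral_cbox(2)[OF c supp] by simp
  then have "((\<lambda>y. g y * v y) has_integral 0) (cbox (- a) a)"
    using integrable_integral[OF integrable_continuous[OF continuous_on_subset[OF c subset_UNIV]]]
    by metis
  moreover have "x \<in> box (- a) a"
  proof -
    have m: "x - 1 \<in> cbox (- a) a" "x + 1 \<in> cbox (- a) a" using a by auto
    have "- a $ i < x $ i \<and> x $ i < a $ i" for i
      using m[unfolded mem_box_cart, THEN spec, of i] by simp
    then show ?thesis by (simp add: mem_box_cart)
  qed
  ultimately have "g x * v x = 0"
    using has_integral_0_cbox_imp_0[OF continuous_on_subset[OF c], of "- a" a x] gv box_subset_cbox
    by (metis (no_types, lifting) subset_UNIV empty_iff subsetD)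
  then show False
    using \<open>g x > 0\<close> v(3) by simp
qed

section \<open>The first variation and the Euler--Lagrange expression\<close>

definition jet :: "(real^'n \<Rightarrow> real) \<Rightarrow> real^'n \<Rightarrow> (real^'n) \<times> real \<times> (real^'n)" where
  "jet u x = (x, u x, grad u x)"

text \<open>The divergence term stays a derivative of the composite function of x, unexpanded: this
  is the form that integration by parts produces, and it simplifies at once where \<open>u\<close>
  is locally constant.\<close>

definition euler_lagrange ::
  "((real^'n) \<times> real \<times> (real^'n) \<Rightarrow> real) \<Rightarrow> (real^'n \<Rightarrow> real) \<Rightarrow> real^'n \<Rightarrow> real" where
  "euler_lagrange L u x = partial_deriv dir_u L (jet u x) -
     (\<Sum>i\<in>UNIV. partial_deriv (axis i 1) (\<lambda>y. partial_deriv (dir_z i) L (jet u y)) x)"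

lemma partial_deriv_jet_direction:
  fixes L :: "(real^'n) \<times> real \<times> (real^'n) \<Rightarrow> real"
  assumes "L differentiable (at p)"
  shows "partial_deriv (0, s, w) L p =
    s * partial_deriv dir_u L p + (\<Sum>i\<in>UNIV. w $ i * partial_deriv (dir_z i) L p)"
proof -
  have l: "linear (frechet_derivative L (at p))"
    using assms by (rule linear_frechet_derivative)
  have *: "(\<Sum>i\<in>UNIV. w $ i *\<^sub>R dir_z i) = (0, 0, w)"
  proof -
    have "(\<Sum>i\<in>UNIV. w $ i *\<^sub>R dir_z i) = (0, 0, \<Sum>i\<in>UNIV. w $ i *\<^sub>R axis i 1)"
      by (simp add: dir_z_def sum_prod)
    moreover have "(\<Sum>i\<in>UNIV. w $ i *\<^sub>R axis i 1) = w"
      using basis_expansion[of w] by (simp add: scalar_mult_eq_scaleR)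
    ultimately show ?thesis by simp
  qed
  have "(0, s, w) = s *\<^sub>R dir_u + (\<Sum>i\<in>UNIV. w $ i *\<^sub>R dir_z i)"
    by (simp add: * dir_u_def)
  then show ?thesis
    by (simp add: partial_deriv_def linear_add[OF l] linear_sum[OF l] linear_scale[OF l])
qed

lemma Ck1_jet:
  assumes "Ck_on 2 \<Omega> u"
  shows "Ck_on 1 \<Omega> (jet u)"
  unfolding jet_def
  by (intro Ck1_Pair Ck1_grad Ck2_imp_Ck1(1) assms Ck1_bounded_linear bounded_linear_ident)

text \<open>The composite already uses one derivative of L and one of \<open>u\<close>; C^2
  regularity of both leaves the one further derivative taken in
  \<open>euler_lagrange\<close>.\<close>

lemma Ck1_partial_deriv_jet:
  assumes "Ck_on 2 (\<Omega> \<times> UNIV \<times> UNIV) L" "Ck_on 2 \<Omega> u"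
  shows "Ck_on 1 \<Omega> (\<lambda>x. partial_deriv e L (jet u x))"
  by (rule Ck1_compose[OF Ck2_imp_Ck1(2)[OF assms(1)] Ck1_jet[OF assms(2)]])
    (auto simp: jet_def)

lemma continuous_on_euler_lagrange:
  assumes "Ck_on 2 (\<Omega> \<times> UNIV \<times> UNIV) L" "Ck_on 2 \<Omega> u"
  shows "continuous_on \<Omega> (euler_lagrange L u)"
  unfolding euler_lagrange_def
  by (intro continuous_intros Ck1_continuous_on Ck1_continuous_partial_deriv
      Ck1_partial_deriv_jet assms)

text \<open>C^2 regularity inside the domain gives no bound near the boundary. The global C^1
  extensions do: with them the integrand extends continuously to the compact closure.\<close>

lemma set_integrable_lagrangian:
  fixes L :: "(real^'n) \<times> real \<times> (real^'n) \<Rightarrow> real"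
  assumes \<Omega>: "open \<Omega>" "bounded \<Omega>"
    and L: "C1_closure (\<Omega> \<times> UNIV \<times> UNIV) L" and u: "C1_closure \<Omega> u"
  shows "set_integrable lborel \<Omega> (\<lambda>x. L (jet u x))"
proof -
  obtain F where F: "Ck_on 1 UNIV F" "\<And>p. p \<in> \<Omega> \<times> UNIV \<times> UNIV \<Longrightarrow> F p = L p"
    using L by (auto simp: C1_closure_def)
  obtain G where G: "Ck_on 1 UNIV G" "\<And>x. x \<in> \<Omega> \<Longrightarrow> G x = u x"
    using u by (auto simp: C1_closure_def)
  have "continuous_on UNIV (jet G)"
    unfolding jet_def
    by (intro continuous_intros Ck1_continuous_on[OF G(1)] continuous_on_grad[OF G(1)])
  then have "continuous_on UNIV (\<lambda>x. F (jet G x))"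
    by (rule continuous_on_compose2[OF Ck1_continuous_on[OF F(1)]]) auto
  then have "set_integrable lborel (closure \<Omega>) (\<lambda>x. F (jet G x))"
    unfolding set_integrable_def using \<Omega>(2)
    by (intro borel_integrable_compact) (auto intro: continuous_on_subset simp: compact_closure)
  then have "set_integrable lborel \<Omega> (\<lambda>x. F (jet G x))"
    by (rule set_integrable_subset) (use \<Omega> closure_subset in auto)
  moreover have "F (jet G x) = L (jet u x)" if "x \<in> \<Omega>" for x
  proof -
    have "grad G x = grad u x"
      using partial_deriv_cong_open[OF \<Omega>(1) that, of G u] G(2) by (simp add: grad_def)
    then show ?thesis
      using F(2) G(2) that by (simp add: jet_def)
  qed
  ultimately show ?thesis
    by (simp cong: set_integrable_cong)
qed

lemma grad_eq_0_outside:
  assumes "compact K" "\<And>x. x \<notin> K \<Longrightarrow> v x = 0" "x \<notin> K"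
  shows "grad v x = 0"
proof -
  have "partial_deriv e v x = partial_deriv e (\<lambda>_. 0) x" for e
    by (rule partial_deriv_cong_open[of "- K"])
      (use assms in \<open>auto simp: compact_imp_closed open_Compl\<close>)
  then show ?thesis
    by (simp add: vec_eq_iff grad_component partial_derivI[of "\<lambda>_. 0" "\<lambda>_. 0"])
qed

text \<open>Stated for C^1 functions v so as to cover test functions and inner variations alike.
  Differentiation under the integral is followed by integration by parts.\<close>

lemma first_variation_eq:
  fixes \<Omega> :: "(real^'n) set"
  assumes \<Omega>: "open \<Omega>" "bounded \<Omega>"
    and L: "Ck_on 2 (\<Omega> \<times> UNIV \<times> UNIV) L" "C1_closure (\<Omega> \<times> UNIV \<times> UNIV) L"
    and u: "Ck_on 2 \<Omega> u" "C1_closure \<Omega> u"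
    and v: "Ck_on 1 \<Omega> v" and K: "compact K" "K \<subseteq> \<Omega>" "\<And>x. x \<notin> K \<Longrightarrow> v x = 0"
  shows "first_variation (functional \<Omega> L) u v = (LINT x|lborel. euler_lagrange L u x * v x)"
proof -
  note u1 = Ck2_imp_Ck1(1)[OF u(1)] and L1 = Ck2_imp_Ck1(1)[OF L(1)]
  have v1: "Ck_on 1 UNIV v"
    by (rule Ck1_extend_zero[OF \<Omega>(1) K(1,2) v K(3)])
  have gv: "grad v x = 0" if "x \<notin> K" for x
    by (rule grad_eq_0_outside[OF K(1,3) that])
  have bK: "bounded K" using K(1) by (rule compact_imp_bounded)
  define q where "q t x = (x, u x + t * v x, grad u x + t *\<^sub>R grad v x)" for t x
  \<comment> \<open>Subtracting the integrand at t = 0 leaves a function supported in K, since v and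
    its gradient vanish off K.\<close>
  define g where "g t x = (if x \<in> \<Omega> then L (q t x) - L (q 0 x) else 0)" for t x
  define g' where "g' t x = (if x \<in> \<Omega> then partial_deriv (0, v x, grad v x) L (q t x) else 0)" for t x
  have qL: "L differentiable (at (q t x))" if "x \<in> \<Omega>" for t x
    using L1 that by (simp add: q_def)
  have g0: "g t x = 0" "g' t x = 0" if "x \<notin> K" for t x
  proof -
    have "v x = 0" "grad v x = 0" using K(3) gv that by auto
    then show "g t x = 0" "g' t x = 0"
      using partial_deriv_jet_direction[OF qL, of x 0 0 t] by (simp_all add: g_def g'_def q_def)
  qed
  have cq: "continuous_on (UNIV \<times> \<Omega>) (\<lambda>(t, x). q t x)"
  proof -
    have "continuous_on (UNIV \<times> \<Omega>) (\<lambda>z. f (snd z))" if "continuous_on \<Omega> f" for f :: "real^'n \<Rightarrow> 'z::topological_space"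
      by (rule continuous_on_compose2[OF that]) (auto intro: continuous_intros)
    note c = this
    show ?thesis
      unfolding q_def split_def
      by (intro continuous_intros c Ck1_continuous_on[OF u1] Ck1_continuous_on[OF v]
          continuous_on_grad[OF u1] continuous_on_grad[OF v])
  qed
  have cg: "continuous_on UNIV (g t)" for t
  proof (rule continuous_on_extend_zero[OF \<Omega>(1) K(1,2)])
    have "continuous_on \<Omega> (\<lambda>x. L (q t x))" for t
    proof (rule continuous_on_compose2[OF Ck1_continuous_on[OF L1]])
      show "continuous_on \<Omega> (q t)"
        using continuous_on_compose2[OF cq, of \<Omega> "\<lambda>x. (t, x)"] image_subset_iff[of "Pair t" \<Omega>]
        by (simp add: continuous_on_Pair continuous_on_id continuous_on_const)
    qed (auto simp: q_def)
    then have "continuous_on \<Omega> (\<lambda>x. L (q t x) - L (q 0 x))"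
      by (intro continuous_intros)
    then show "continuous_on \<Omega> (g t)"
      by (rule continuous_on_eq) (simp add: g_def)
  qed (rule g0)
  have deriv: "((\<lambda>t. LINT x|lborel. g t x) has_real_derivative (LINT x|lborel. g' 0 x)) (at 0)"
  proof (rule has_derivative_integral_bounded_support)
    show "((\<lambda>t. g t x) has_real_derivative g' t x) (at t)" for t x
    proof (cases "x \<in> \<Omega>")
      case True
      have q: "q t x = jet u x + t *\<^sub>R (0, v x, grad v x)" for t
        by (simp add: q_def jet_def)
      have "((\<lambda>t. L (q t x)) has_real_derivative g' t x) (at t)"
        unfolding has_real_derivative_iff_has_vector_derivative g'_def q if_P[OF True]
        by (rule has_vector_derivative_line[OF L1]) (use True in \<open>simp add: jet_def\<close>)
      then have "((\<lambda>t. L (q t x) - L (q 0 x)) has_real_derivative g' t x - 0) (at t)"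
        by (intro derivative_intros)
      then show ?thesis
        using True by (simp add: g_def)
    qed (simp add: g_def g'_def)
    \<comment> \<open>L is regular over \<open>\<Omega>\<close> only, so joint continuity is glued
      from \<open>\<Omega>\<close> and the complement of K, where \<open>g'\<close> is zero.\<close>
    have "continuous_on (UNIV \<times> \<Omega>) (\<lambda>z. g' (fst z) (snd z))"
    proof (rule continuous_on_eq)
      show "continuous_on (UNIV \<times> \<Omega>)
          (\<lambda>z. partial_deriv (0, v (snd z), grad v (snd z)) L (q (fst z) (snd z)))"
      proof (rule Ck1_continuous_on_partial_deriv_joint[OF L1])
        show "continuous_on (UNIV \<times> \<Omega>) (\<lambda>z::real \<times> (real^'n). (0::real^'n, v (snd z), grad v (snd z)))"
          by (intro continuous_intros continuous_on_compose2[OF Ck1_continuous_on[OF v1]]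
              continuous_on_compose2[OF continuous_on_grad[OF v1]]) auto
      qed (use cq in \<open>auto simp: split_def q_def\<close>)
    qed (auto simp: g'_def)
    moreover have "continuous_on (UNIV \<times> (- K)) (\<lambda>z. g' (fst z) (snd z))"
      by (rule continuous_on_eq[of _ "\<lambda>_. 0"]) (use g0 in auto)
    moreover have "open ((UNIV::real set) \<times> \<Omega>)" "open ((UNIV::real set) \<times> (- K))"
      using \<Omega> K(1) by (auto intro!: open_Times simp: compact_imp_closed open_Compl)
    ultimately have "continuous_on (UNIV \<times> \<Omega> \<union> UNIV \<times> (- K)) (\<lambda>z. g' (fst z) (snd z))"
      by (intro continuous_on_open_Un)
    moreover have "UNIV \<times> \<Omega> \<union> UNIV \<times> (- K) = (UNIV :: (real \<times> (real^'n)) set)"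
      using K(2) by auto
    ultimately show "continuous_on UNIV (\<lambda>(t, x). g' t x)"
      unfolding split_def by simp
    show "continuous_on UNIV (g t)" for t by (rule cg)
    show "bounded K" by (rule bK)
    show "g t x = 0" if "x \<notin> K" for t x
      using g0(1) that .
  qed
  have ig: "integrable lborel (g t)" for t
    by (rule integrable_bounded_support[OF cg bK g0(1)])
  \<comment> \<open>The integral splits because the integrand at t = 0 is itself integrable.\<close>
  have J: "functional \<Omega> L (\<lambda>x. u x + t * v x) = functional \<Omega> L u + (LINT x|lborel. g t x)" for t
  proof -
    have "indicator \<Omega> x *\<^sub>R L (x, u x + t * v x, grad (\<lambda>x. u x + t * v x) x) =
        indicator \<Omega> x *\<^sub>R L (jet u x) + g t x" for x
    proof (cases "x \<in> \<Omega>")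
      case True
      have "grad (\<lambda>x. u x + t * v x) x = grad u x + t *\<^sub>R grad v x"
        using u1 v True by (intro grad_add_scaleR) simp_all
      then show ?thesis using True by (simp add: g_def q_def jet_def)
    qed (simp add: g_def)
    then show ?thesis
      unfolding functional_def set_lebesgue_integral_def
      using set_integrable_lagrangian[OF \<Omega> L(2) u(2)] ig
      by (simp add: set_integrable_def jet_def)
  qed
  let ?p = "\<lambda>i x. partial_deriv (dir_z i) L (jet u x)"
  let ?E = "euler_lagrange L u"
  have p: "Ck_on 1 \<Omega> (?p i)" for i
    by (rule Ck1_partial_deriv_jet[OF L(1) u(1)])
  have pv: "Ck_on 1 UNIV (\<lambda>x. ?p i x * v x)" for i
    by (rule Ck1_extend_zero[OF \<Omega>(1) K(1,2)]) (use Ck1_mult[OF p v] K(3) in auto)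
  have pv0: "partial_deriv (axis i 1) (\<lambda>x. ?p i x * v x) x = 0" if "x \<notin> K" for i x
    using grad_eq_0_outside[OF K(1) _ that, of "\<lambda>x. ?p i x * v x"] K(3)
    by (simp add: vec_eq_iff grad_component)
  have ipv: "integrable lborel (partial_deriv (axis i 1) (\<lambda>x. ?p i x * v x))" for i
    by (rule integrable_bounded_support[OF Ck1_continuous_partial_deriv[OF pv] bK pv0])
  have iE: "integrable lborel (\<lambda>x. ?E x * v x)"
  proof (rule integrable_bounded_support[OF _ bK])
    show "continuous_on UNIV (\<lambda>x. ?E x * v x)"
      by (rule continuous_on_extend_zero[OF \<Omega>(1) K(1,2)])
        (use continuous_on_euler_lagrange[OF L(1) u(1)] Ck1_continuous_on[OF v] K(3) in
          \<open>auto intro: continuous_on_mult\<close>)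
  qed (simp add: K(3))
  \<comment> \<open>Product rule: the integrand is E v plus the divergence of the field with
    components L_{z_i} v, whose integral is zero.\<close>
  have "g' 0 x = ?E x * v x + (\<Sum>i\<in>UNIV. partial_deriv (axis i 1) (\<lambda>x. ?p i x * v x) x)" for x
  proof (cases "x \<in> K")
    case True
    then have x: "x \<in> \<Omega>" using K(2) by auto
    have "partial_deriv (axis i 1) (\<lambda>x. ?p i x * v x) x =
        ?p i x * grad v x $ i + partial_deriv (axis i 1) (?p i) x * v x" for i
      unfolding grad_component
      by (rule partial_derivI[OF has_derivative_mult[OF Ck1_has_derivative[OF p x] Ck1_has_derivative[OF v x]]])
    moreover have "q 0 x = jet u x"
      by (simp add: q_def jet_def)
    ultimately show ?thesis
      using x qL[OF x, of 0]
      by (simp add: g'_def partial_deriv_jet_direction euler_lagrange_def sum.distrib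
          sum_distrib_left algebra_simps)
  next
    case False
    then show ?thesis using g0 pv0 K(3) by simp
  qed
  then have "(LINT x|lborel. g' 0 x) = (LINT x|lborel. ?E x * v x) +
      (\<Sum>i\<in>UNIV. LINT x|lborel. partial_deriv (axis i 1) (\<lambda>x. ?p i x * v x) x)"
    using iE ipv by simp
  also have "\<dots> = (LINT x|lborel. ?E x * v x)"
    using integral_partial_deriv_eq_0[OF pv bK] K(3) by simp
  finally have "((\<lambda>t. functional \<Omega> L (\<lambda>x. u x + t * v x)) has_real_derivative
      (LINT x|lborel. ?E x * v x)) (at 0)"
    unfolding J using deriv by (auto intro!: derivative_eq_intros)
  then show ?thesis
    unfolding first_variation_def by (rule DERIV_imp_deriv)
qed

section \<open>The Euler-Lagrange expression where the gradient vanishes\<close>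

lemma constant_on_ball_if_grad_0:
  fixes u :: "real^'n \<Rightarrow> real"
  assumes "\<And>y. y \<in> ball x r \<Longrightarrow> u differentiable (at y)" "\<And>y. y \<in> ball x r \<Longrightarrow> grad u y = 0"
  shows "\<exists>c. \<forall>y\<in>ball x r. u y = c"
proof (rule has_derivative_zero_constant)
  fix y assume y: "y \<in> ball x r"
  have "partial_deriv e u y = 0" for e
  proof -
    have "partial_deriv b u y = 0" if "b \<in> Basis" for b
      using that assms(2)[OF y] by (auto simp: Basis_vec_def grad_def vec_eq_iff[of "vec_lambda _"])
    then show ?thesis
      by (subst partial_deriv_sum_Basis[OF assms(1)[OF y]]) simp
  qed
  then show "(u has_derivative (\<lambda>h. 0)) (at y within ball x r)"
    using assms(1)[OF y] frechet_derivative_works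
    by (metis (no_types, lifting) ext has_derivative_at_withinI partial_deriv_def)
qed (rule convex_ball)

text \<open>On the ball \<open>u\<close> is a constant c and the jet is (y, c, 0), so derivatives of
  composites with the jet are pure x-derivatives of L. The first identity removes the divergence
  term, the second the gradient of what remains.\<close>

lemma euler_lagrange_locally_constant:
  fixes \<Omega> :: "(real^'n) set"
  assumes \<Omega>: "open \<Omega>" "ball x r \<subseteq> \<Omega>"
    and L: "Ck_on 2 (\<Omega> \<times> UNIV \<times> UNIV) L" and u: "Ck_on 2 \<Omega> u"
    and xz: "\<And>x s. x \<in> \<Omega> \<Longrightarrow>
           (\<Sum>i\<in>UNIV. partial_deriv (dir_z i) (partial_deriv (dir_x i) L) (x, s, 0)) = 0"
    and xu: "\<And>x s i. x \<in> \<Omega> \<Longrightarrow> partial_deriv dir_u (partial_deriv (dir_x i) L) (x, s, 0) = 0"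
    and grad0: "\<And>y. y \<in> ball x r \<Longrightarrow> grad u y = 0"
  shows "\<exists>c. \<forall>y\<in>ball x r. euler_lagrange L u y = c"
proof -
  have op: "open (\<Omega> \<times> (UNIV :: real set) \<times> (UNIV :: (real^'n) set))"
    using \<Omega>(1) by (intro open_Times) auto
  obtain c where c: "\<And>y. y \<in> ball x r \<Longrightarrow> u y = c"
    using constant_on_ball_if_grad_0[of x r u] grad0 Ck2_imp_Ck1(1)[OF u] \<Omega>(2)
    by (metis Ck1_has_derivative differentiable_def subsetD)
  have jet: "jet u y = (y, c, 0)" if "y \<in> ball x r" for y
    using that by (simp add: jet_def c grad0)
  have slice: "((\<lambda>y. partial_deriv d L (y, c, 0)) has_derivative
      (\<lambda>e. partial_deriv (e, 0, 0) (partial_deriv d L) (y, c, 0))) (at y)" if "y \<in> ball x r" for d y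
    by (rule has_derivative_compose[where f="\<lambda>y. (y, c, 0)" and f'="\<lambda>e. (e, 0, 0)",
          OF _ Ck1_has_derivative[OF Ck2_imp_Ck1(2)[OF L]]])
      (use that \<Omega>(2) in \<open>auto intro!: has_derivative_Pair has_derivative_const has_derivative_ident\<close>)
  have E: "euler_lagrange L u y = partial_deriv dir_u L (y, c, 0)" if y: "y \<in> ball x r" for y
  proof -
    have "partial_deriv (axis i 1) (\<lambda>y. partial_deriv (dir_z i) L (jet u y)) y =
        partial_deriv (dir_z i) (partial_deriv (dir_x i) L) (y, c, 0)" for i
    proof -
      have "partial_deriv (axis i 1) (\<lambda>y. partial_deriv (dir_z i) L (jet u y)) y =
          partial_deriv (axis i 1) (\<lambda>y. partial_deriv (dir_z i) L (y, c, 0)) y"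
        by (rule partial_deriv_cong_open[OF open_ball y]) (simp add: jet)
      also have "\<dots> = partial_deriv (dir_x i) (partial_deriv (dir_z i) L) (y, c, 0)"
        unfolding dir_x_def by (rule partial_derivI[OF slice[OF y]])
      \<comment> \<open>The order is exchanged to match the hypothesis, which differentiates in x
        first.\<close>
      also have "\<dots> = partial_deriv (dir_z i) (partial_deriv (dir_x i) L) (y, c, 0)"
        by (rule partial_deriv_commute[OF op _ L]) (use y \<Omega>(2) in auto)
      finally show ?thesis .
    qed
    then show ?thesis
      using xz[of y c] y \<Omega>(2) by (auto simp: euler_lagrange_def jet)
  qed
  have "\<exists>d. \<forall>y\<in>ball x r. partial_deriv dir_u L (y, c, 0) = d"
  proof (rule constant_on_ball_if_grad_0)
    fix y assume y: "y \<in> ball x r"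
    show "(\<lambda>y. partial_deriv dir_u L (y, c, 0)) differentiable (at y)"
      using slice[OF y] unfolding differentiable_def by blast
    have "partial_deriv (axis i 1) (\<lambda>y. partial_deriv dir_u L (y, c, 0)) y = 0" for i
    proof -
      have "partial_deriv (axis i 1) (\<lambda>y. partial_deriv dir_u L (y, c, 0)) y =
          partial_deriv (dir_x i) (partial_deriv dir_u L) (y, c, 0)"
        unfolding dir_x_def by (rule partial_derivI[OF slice[OF y]])
      also have "\<dots> = partial_deriv dir_u (partial_deriv (dir_x i) L) (y, c, 0)"
        by (rule partial_deriv_commute[OF op _ L]) (use y \<Omega>(2) in auto)
      finally show ?thesis
        using xu y \<Omega>(2) by auto
    qed
    then show "grad (\<lambda>y. partial_deriv dir_u L (y, c, 0)) y = 0"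
      by (simp add: vec_eq_iff grad_component)
  qed
  then show ?thesis using E by simp
qed

section \<open>Regularity and support of the admissible variations\<close>

lemma test_function_Ck1:
  assumes "v \<in> test_functions \<Omega>"
  shows "Ck_on 1 \<Omega> v"
  using assms unfolding test_functions_def by blast

text \<open>Supplies the vanishing components of a field h that points in a single coordinate
  direction.\<close>

lemma zero_test_function:
  fixes \<Omega> :: "(real^'n) set"
  shows "(\<lambda>_. 0) \<in> test_functions \<Omega>"
proof -
  have "partial_deriv e (\<lambda>_::real^'n. 0::real) = (\<lambda>_. 0)" for e
    by (simp add: fun_eq_iff partial_derivI[of _ "\<lambda>_. 0"])
  then have "Ck_on k \<Omega> (\<lambda>_. 0::real)" for k
    by (induction k) auto
  then show ?thesis by (simp add: test_functions_def)
qed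

text \<open>The components of h are finitely many, so the union of their supports is compact. One
  derivative of \<open>u\<close> is spent, which leaves C^1.\<close>

lemma inner_variation_support:
  assumes u: "Ck_on 2 \<Omega> u" and w: "w \<in> inner_variations \<Omega> u"
  obtains K where "Ck_on 1 \<Omega> w" "compact K" "K \<subseteq> \<Omega>" "\<And>x. x \<notin> K \<Longrightarrow> w x = 0"
proof -
  obtain h where h: "\<And>i. (\<lambda>x. h x $ i) \<in> test_functions \<Omega>"
    and w_eq: "w = (\<lambda>x. \<Sum>i\<in>UNIV. partial_deriv (axis i 1) u x * h x $ i)"
    using w by (auto simp: inner_variations_def vector_test_functions_def)
  have "\<exists>K. compact K \<and> K \<subseteq> \<Omega> \<and> (\<forall>x. x \<notin> K \<longrightarrow> h x $ i = 0)" for i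
    using test_function_support[OF h[of i]] by metis
  then obtain K where K: "\<And>i. compact (K i)" "\<And>i. K i \<subseteq> \<Omega>" "\<And>i x. x \<notin> K i \<Longrightarrow> h x $ i = 0"
    by metis
  show thesis
  proof
    show "Ck_on 1 \<Omega> w"
      unfolding w_eq
      by (intro Ck1_sum Ck1_mult Ck2_imp_Ck1(2)[OF u] test_function_Ck1[OF h]) simp
    show "compact (\<Union>i. K i)" "(\<Union>i. K i) \<subseteq> \<Omega>"
      using K by auto
    show "w x = 0" if "x \<notin> (\<Union>i. K i)" for x
      using that K(3) by (simp add: w_eq)
  qed
qed

theorem theorem5:
  fixes \<Omega> :: "(real^'n) set"
    and L :: "(real^'n) \<times> real \<times> (real^'n) \<Rightarrow> real"
    and u :: "real^'n \<Rightarrow> real"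
  assumes "open \<Omega>" and "connected \<Omega>" and "bounded \<Omega>"
    and "Ck_on 2 (\<Omega> \<times> UNIV \<times> UNIV) L"
    and "C1_closure (\<Omega> \<times> UNIV \<times> UNIV) L"
    and "\<And>x s. x \<in> \<Omega> \<Longrightarrow>
           (\<Sum>i\<in>UNIV. partial_deriv (dir_z i) (partial_deriv (dir_x i) L) (x, s, 0)) = 0"
    and "\<And>x s i. x \<in> \<Omega> \<Longrightarrow>
           partial_deriv dir_u (partial_deriv (dir_x i) L) (x, s, 0) = 0"
    and "Ck_on 2 \<Omega> u"
    and "C1_closure \<Omega> u"
    and "\<exists>x\<in>\<Omega>. grad u x \<noteq> 0"
  shows "(\<forall>v\<in>test_functions \<Omega>. first_variation (functional \<Omega> L) u v = 0) \<longleftrightarrow>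
         (\<forall>w\<in>inner_variations \<Omega> u. first_variation (functional \<Omega> L) u w = 0)"
proof -
  let ?E = "euler_lagrange L u"
  note variation = first_variation_eq[OF assms(1,3,4,5,8,9)]
  have cE: "continuous_on \<Omega> ?E"
    by (rule continuous_on_euler_lagrange[OF assms(4,8)])
  have test: "first_variation (functional \<Omega> L) u v = (LINT x|lborel. ?E x * v x)"
    if "v \<in> test_functions \<Omega>" for v
    using test_function_support[OF that] variation[OF test_function_Ck1[OF that]] by metis
  have inner: "first_variation (functional \<Omega> L) u w = (LINT x|lborel. ?E x * w x)"
    if "w \<in> inner_variations \<Omega> u" for w
    using inner_variation_support[OF assms(8) that] variation by metis
  have E0_inner: "first_variation (functional \<Omega> L) u w = 0"
    if "\<And>x. x \<in> \<Omega> \<Longrightarrow> ?E x = 0" "w \<in> inner_variations \<Omega> u" for w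
  proof -
    \<comment> \<open>Off the domain nothing is known about E, but there w vanishes.\<close>
    have "(\<lambda>x. ?E x * w x) = (\<lambda>_. 0)"
      using inner_variation_support[OF assms(8) that(2)] that(1) by (metis mult_eq_0_iff subsetD)
    then show ?thesis using inner[OF that(2)] by (simp only: Bochner_Integration.integral_zero)
  qed
  have E0_test: "first_variation (functional \<Omega> L) u v = 0"
    if "\<And>x. x \<in> \<Omega> \<Longrightarrow> ?E x = 0" "v \<in> test_functions \<Omega>" for v
  proof -
    have "(\<lambda>x. ?E x * v x) = (\<lambda>_. 0)"
      using test_function_support[OF that(2)] that(1) by (metis mult_eq_0_iff subsetD)
    then show ?thesis using test[OF that(2)] by (simp only: Bochner_Integration.integral_zero)
  qed
  show ?thesis
  proof
    assume "\<forall>v\<in>test_functions \<Omega>. first_variation (functional \<Omega> L) u v = 0"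
    \<comment> \<open>Inner variations need not be test functions, so E = 0 is extracted before they
      are inserted.\<close>
    then have "?E x = 0" if "x \<in> \<Omega>" for x
      using fundamental_lemma_calculus_of_variations[OF assms(1) cE _ that] test by simp
    then show "\<forall>w\<in>inner_variations \<Omega> u. first_variation (functional \<Omega> L) u w = 0"
      using E0_inner by blast
  next
    assume stationary: "\<forall>w\<in>inner_variations \<Omega> u. first_variation (functional \<Omega> L) u w = 0"
    have "?E x * partial_deriv (axis i 1) u x = 0" if x: "x \<in> \<Omega>" for x i
    proof (rule fundamental_lemma_calculus_of_variations[OF assms(1) _ _ x])
      show "continuous_on \<Omega> (\<lambda>x. ?E x * partial_deriv (axis i 1) u x)"
        by (intro continuous_intros cE Ck1_continuous_partial_deriv Ck2_imp_Ck1(1)[OF assms(8)])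
      fix v assume v: "v \<in> test_functions \<Omega>"
      \<comment> \<open>With v in the i-th component only, Du . h is u_{x_i} v, and the fundamental
        lemma applies to E u_{x_i}.\<close>
      define h :: "real^'n \<Rightarrow> real^'n" where "h x = (\<chi> j. if j = i then v x else 0)" for x
      have "h \<in> vector_test_functions \<Omega>"
        unfolding vector_test_functions_def mem_Collect_eq
      proof
        show "(\<lambda>x. h x $ j) \<in> test_functions \<Omega>" for j
          using v zero_test_function[of \<Omega>] by (cases "j = i") (simp_all add: h_def)
      qed
      moreover
      have "(\<Sum>j\<in>UNIV. partial_deriv (axis j 1) u x * h x $ j) = partial_deriv (axis i 1) u x * v x" for x
        by (simp add: h_def if_distrib cong: if_cong)
      then have "(\<lambda>x. partial_deriv (axis i 1) u x * v x) =
          (\<lambda>x. \<Sum>j\<in>UNIV. partial_deriv (axis j 1) u x * h x $ j)"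
        by simp
      ultimately have "(\<lambda>x. partial_deriv (axis i 1) u x * v x) \<in> inner_variations \<Omega> u"
        unfolding inner_variations_def by blast
      then show "(LINT x|lborel. ?E x * partial_deriv (axis i 1) u x * v x) = 0"
        using stationary inner by (simp add: mult.assoc)
    qed
    then have grad0: "grad u x = 0" if "x \<in> \<Omega>" "?E x \<noteq> 0" for x
      using that by (metis mult_eq_0_iff vec_eq_iff grad_component zero_index)
    have "?E x = 0" if x: "x \<in> \<Omega>" for x
    proof (rule ccontr)
      assume nz: "?E x \<noteq> 0"
      let ?T = "{y \<in> \<Omega>. ?E y = ?E x}"
      have V: "open {y \<in> \<Omega>. ?E y \<noteq> 0}"
        using continuous_open_preimage[OF cE assms(1), of "- {0}"]
        by (simp add: vimage_def Int_def open_Compl)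
      have "open ?T"
        unfolding open_contains_ball
      proof
        fix y assume y: "y \<in> ?T"
        then obtain r where r: "r > 0" "ball y r \<subseteq> {y \<in> \<Omega>. ?E y \<noteq> 0}"
          using V nz unfolding open_contains_ball by force
        then obtain c where "\<forall>z\<in>ball y r. ?E z = c"
          using euler_lagrange_locally_constant[OF assms(1) _ assms(4,8,6,7), of y r] grad0 by blast
        \<comment> \<open>The constant on the ball is the value at its centre y, which is
          \<open>?E x\<close> because y lies in \<open>?T\<close>.\<close>
        then have "ball y r \<subseteq> ?T"
          using r y by auto
        then show "\<exists>r>0. ball y r \<subseteq> ?T" using r(1) by blast
      qed
      then have "openin (top_of_set \<Omega>) ?T"
        by (auto intro: open_subset)
      moreover have "closedin (top_of_set \<Omega>) ?T"
        using continuous_closedin_preimage_constant[OF cE] by simp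
      ultimately have "?T = \<Omega>"
        using assms(2) x unfolding connected_clopen by blast
      then show False
        using assms(10) grad0 nz by (metis (mono_tags, lifting) mem_Collect_eq)
    qed
    then show "\<forall>v\<in>test_functions \<Omega>. first_variation (functional \<Omega> L) u v = 0"
      using E0_test by blast
  qed
qed

end
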